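(* Let $d\ge 1$ and let $u_0\in L^1(\mathbb{R}^d)\cap L^{\infty}(\mathbb{R}^d)$ be real-valued with $\|u_0\|_{L^1}\neq 0$, and suppose that $$\int_{\mathbb{R}^d} e^{\langle\lambda,y\rangle}|u_0(y)|\,dy<\infty\quad\text{for all }\lambda\in\mathbb{R}^d.$$ Let $u$ be the bounded solution on $(0,+\infty)\times\mathbb{R}^d$ of the heat equation $\partial_t u=\Delta_x u$ with initial data $u_0$. Then for any $\eta\in\mathbb{R}^d$ and any non-negative integer $n$, there is a positive constant $C=C(n,d)$, depending only on $n$ and $d$, such that the function $v(t,x):=e^{\langle\eta,x\rangle+t|\eta|^2}u(t,x+2t\eta)$ satisfies $$\left|v(t,x)-G(t,x)\sum_{|\alpha|\le n}\frac{\partial_\eta^{\alpha}U_0(\eta)}{(4t)^{|\alpha|/2}\,\alpha!}\prod_{j=1}^{d}H_{\alpha_j}\!\left(\frac{x_j}{2\sqrt{t}}\right)\right|\le C\,t^{-(n+d+1)/2}\left\|e^{\langle\eta,\cdot\rangle}|\cdot|^{n+1}u_0\right\|_{L^1}$$ for all $x\in\mathbb{R}^d$ and all $t>0$.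
   Context: $|\cdot|$ and $\langle\cdot,\cdot\rangle$ denote the Euclidean norm and inner product on $\mathbb{R}^d$. The bounded solution is $u(t,x)=\int_{\mathbb{R}^d}G(t,x-y)u_0(y)\,dy$, where $G(t,x)=(4\pi t)^{-d/2}e^{-|x|^2/(4t)}$ is the heat kernel. For a multi-index $\alpha=(\alpha_1,\ldots,\alpha_d)\in(\mathbb{N}\cup\{0\})^d$, $|\alpha|:=\sum_{j=1}^d\alpha_j$, $\alpha!:=\alpha_1!\cdots\alpha_d!$, and $\partial_\eta^\alpha$ is the corresponding partial derivative; the sum in the claim is over such multi-indices. The bilateral Laplace transform of $u_0$ is $U_0(\eta):=\int_{\mathbb{R}^d}e^{\langle\eta,y\rangle}u_0(y)\,dy$, $\eta\in\mathbb{R}^d$. The Hermite polynomial of order $m$ is $H_m(x):=(-1)^m e^{x^2}\frac{d^m}{dx^m}\left[e^{-x^2}\right]$, $x\in\mathbb{R}$. *)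

theory Defs
  imports "HOL-Analysis.Analysis"
begin

text \<open>
  The space \<open>\<real>\<^sup>d\<close> is \<^typ>\<open>real ^ 'd\<close>, with \<open>d = CARD('d) \<ge> 1\<close>. Elements of \<open>L\<^sup>1\<close> and
  \<open>L\<^sup>\<infinity>\<close> are represented by Lebesgue measurable functions.
\<close>

text \<open>
  As a Bochner integral this is 0 if \<open>f\<close> is not integrable; it is meant only for integrable \<open>f\<close>.
\<close>

definition L1_norm :: "(real ^ 'd \<Rightarrow> real) \<Rightarrow> real" where
  "L1_norm f = (\<integral>y. \<bar>f y\<bar> \<partial>lebesgue)"

definition in_L1 :: "(real ^ 'd \<Rightarrow> real) \<Rightarrow> bool" where
  "in_L1 f \<longleftrightarrow> integrable lebesgue f"

definition in_Linf :: "(real ^ 'd \<Rightarrow> real) \<Rightarrow> bool" where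
  "in_Linf f \<longleftrightarrow> f \<in> borel_measurable lebesgue \<and> (\<exists>B. AE y in lebesgue. \<bar>f y\<bar> \<le> B)"

definition heat_kernel :: "real \<Rightarrow> real ^ 'd \<Rightarrow> real" where
  "heat_kernel t x =
     (4 * pi * t) powr (- (real CARD('d) / 2)) * exp (- ((norm x)\<^sup>2 / (4 * t)))"

text \<open>The bounded solution of the heat equation with initial datum \<open>u\<^sub>0\<close>.\<close>

definition heat_solution :: "(real ^ 'd \<Rightarrow> real) \<Rightarrow> real \<Rightarrow> real ^ 'd \<Rightarrow> real" where
  "heat_solution u\<^sub>0 t x = (\<integral>y. heat_kernel t (x - y) * u\<^sub>0 y \<partial>lebesgue)"

definition bilateral_laplace :: "(real ^ 'd \<Rightarrow> real) \<Rightarrow> real ^ 'd \<Rightarrow> real" where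
  "bilateral_laplace u\<^sub>0 \<eta> = (\<integral>y. exp (\<eta> \<bullet> y) * u\<^sub>0 y \<partial>lebesgue)"

definition hermite :: "nat \<Rightarrow> real \<Rightarrow> real" where
  "hermite m x = (- 1) ^ m * exp (x\<^sup>2) * (deriv ^^ m) (\<lambda>s. exp (- (s\<^sup>2))) x"

text \<open>A multi-index is a function \<^typ>\<open>'d \<Rightarrow> nat\<close>.\<close>

definition mi_abs :: "('d::finite \<Rightarrow> nat) \<Rightarrow> nat" where
  "mi_abs \<alpha> = (\<Sum>j\<in>UNIV. \<alpha> j)"

definition mi_fact :: "('d::finite \<Rightarrow> nat) \<Rightarrow> real" where
  "mi_fact \<alpha> = (\<Prod>j\<in>UNIV. fact (\<alpha> j))"

definition partial_deriv :: "'d \<Rightarrow> (real ^ 'd \<Rightarrow> real) \<Rightarrow> real ^ 'd \<Rightarrow> real" where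
  "partial_deriv j f x = deriv (\<lambda>s. f (x + s *\<^sub>R axis j 1)) 0"

text \<open>
  The index type \<^typ>\<open>'d\<close> carries no order, so the order in which the coordinate derivatives are
  taken is fixed by an arbitrary enumeration of the coordinates. For smooth functions the result
  does not depend on it.
\<close>

definition coord_enum :: "'d::finite list" where
  "coord_enum = (SOME js. distinct js \<and> set js = UNIV)"

definition mi_deriv :: "('d \<Rightarrow> nat) \<Rightarrow> (real ^ 'd \<Rightarrow> real) \<Rightarrow> real ^ 'd \<Rightarrow> real" where
  "mi_deriv \<alpha> f = foldr (\<lambda>j. partial_deriv j ^^ \<alpha> j) coord_enum f"

end

theory Submission
  imports Defs "HOL-Computational_Algebra.Polynomial"
begin

text \<open>
  Completing the square turns \<open>v(t,x)\<close> into the integral of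
  \<open>G(t,x - y) e\<^sup>\<eta>\<^sup>y u\<^sub>0(y)\<close>. With \<open>z = x / (2 \<surd>t)\<close> and \<open>w = y / (2 \<surd>t)\<close> the kernel is a multiple of
  \<open>exp (- |z - w|\<^sup>2)\<close>, whose Taylor expansion in \<open>w\<close> about \<open>0\<close> has the Hermite coefficients
  and, since all derivatives of the Gaussian are bounded, a remainder of size \<open>|w|\<^sup>n\<^sup>+\<^sup>1\<close>
  uniformly in \<open>z\<close>. Integrating the expansion, the monomial \<open>y\<^sup>\<alpha>\<close> contributes the
  derivative \<open>\<partial>\<^sup>\<alpha>U\<^sub>0(\<eta>)\<close>.
\<close>

section \<open>Derivatives of the one-dimensional Gaussian\<close>

text \<open>Differentiating p(s) exp(-s^2) gives (p'(s) - 2 s p(s)) exp(-s^2), so this shape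
  survives every derivative. Both the smoothness and the boundedness of the iterated derivatives are
  read off from it.\<close>

lemma higher_deriv_gauss_poly:
  "\<exists>p. (deriv ^^ m) (\<lambda>s. exp (- (s\<^sup>2))) = (\<lambda>s::real. poly p s * exp (- (s\<^sup>2)))"
proof (induction m)
  case 0
  have "(\<lambda>s::real. exp (- (s\<^sup>2))) = (\<lambda>s. poly 1 s * exp (- (s\<^sup>2)))" by simp
  then show ?case by (metis funpow_0)
next
  case (Suc m)
  then obtain p where p: "(deriv ^^ m) (\<lambda>s. exp (- (s\<^sup>2))) = (\<lambda>s::real. poly p s * exp (- (s\<^sup>2)))"
    by blast
  have "((\<lambda>s::real. poly p s * exp (- (s\<^sup>2))) has_real_derivative
      poly (pderiv p - [:0, 2:] * p) s * exp (- (s\<^sup>2))) (at s)" for s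
    by (auto intro!: derivative_eq_intros simp: algebra_simps)
  then have "deriv (\<lambda>s::real. poly p s * exp (- (s\<^sup>2))) =
      (\<lambda>s. poly (pderiv p - [:0, 2:] * p) s * exp (- (s\<^sup>2)))"
    by (auto intro: DERIV_imp_deriv)
  with p show ?case
    by (intro exI[of _ "pderiv p - [:0, 2:] * p"]) simp
qed

text \<open>Since \<open>deriv\<close> is a choice operator, its iterates are genuine derivatives
  only once differentiability is known; the form polynomial times Gaussian supplies this.\<close>

lemma has_real_derivative_higher_deriv_gauss:
  "((deriv ^^ m) (\<lambda>s. exp (- (s\<^sup>2))) has_real_derivative
    (deriv ^^ Suc m) (\<lambda>s. exp (- (s\<^sup>2))) x) (at (x::real))"
proof -
  obtain p where p: "(deriv ^^ m) (\<lambda>s. exp (- (s\<^sup>2))) = (\<lambda>s::real. poly p s * exp (- (s\<^sup>2)))"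
    using higher_deriv_gauss_poly by blast
  have "(\<lambda>s::real. poly p s * exp (- (s\<^sup>2))) field_differentiable at x"
    unfolding field_differentiable_def
    by (rule exI, (rule derivative_intros refl)+)
  then show ?thesis
    using p DERIV_deriv_iff_field_differentiable by fastforce
qed

text \<open>A single term of the exponential series gives |x|^i <= i! exp |x|, and |x| - x^2 <= 1
  follows from (|x| - 1)^2 >= 0.\<close>

lemma power_times_gauss_bounded:
  "\<bar>x ^ i * exp (- (x\<^sup>2))\<bar> \<le> fact i * exp 1" for x :: real
proof -
  have "\<bar>x\<bar> ^ i / fact i \<le> exp \<bar>x\<bar>"
    using sum_le_suminf[OF summable_exp[of "\<bar>x\<bar>"], of "{i}"]
    by (simp add: exp_def scaleR_conv_of_real divide_inverse mult.commute)
  then have "\<bar>x\<bar> ^ i \<le> fact i * exp \<bar>x\<bar>"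
    by (simp add: field_simps)
  then have "\<bar>x\<bar> ^ i * exp (- (x\<^sup>2)) \<le> fact i * exp \<bar>x\<bar> * exp (- (x\<^sup>2))"
    by (intro mult_right_mono) auto
  also have "\<dots> = fact i * exp (\<bar>x\<bar> - x\<^sup>2)"
    by (simp add: exp_diff exp_minus field_simps)
  also have "\<bar>x\<bar> - x\<^sup>2 \<le> 1"
    using zero_le_power2[of "\<bar>x\<bar> - 1"] by (simp add: power2_eq_square algebra_simps)
  finally show ?thesis
    by (simp add: abs_mult power_abs)
qed

lemma higher_deriv_gauss_bounded:
  "\<exists>M. \<forall>x::real. \<bar>(deriv ^^ m) (\<lambda>s. exp (- (s\<^sup>2))) x\<bar> \<le> M"
proof -
  obtain p where p: "(deriv ^^ m) (\<lambda>s. exp (- (s\<^sup>2))) = (\<lambda>s::real. poly p s * exp (- (s\<^sup>2)))"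
    using higher_deriv_gauss_poly by blast
  have "\<bar>poly p x * exp (- (x\<^sup>2))\<bar> \<le> (\<Sum>i\<le>degree p. \<bar>coeff p i\<bar> * (fact i * exp 1))" for x
  proof -
    have "\<bar>poly p x * exp (- (x\<^sup>2))\<bar> = \<bar>\<Sum>i\<le>degree p. coeff p i * (x ^ i * exp (- (x\<^sup>2)))\<bar>"
      by (simp add: poly_altdef sum_distrib_right mult.assoc)
    also have "\<dots> \<le> (\<Sum>i\<le>degree p. \<bar>coeff p i\<bar> * \<bar>x ^ i * exp (- (x\<^sup>2))\<bar>)"
      by (rule order_trans[OF sum_abs]) (simp add: abs_mult)
    also have "\<dots> \<le> (\<Sum>i\<le>degree p. \<bar>coeff p i\<bar> * (fact i * exp 1))"
      by (intro sum_mono mult_left_mono power_times_gauss_bounded) auto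
    finally show ?thesis .
  qed
  with p show ?thesis by auto
qed

section \<open>Multi-indices and the Leibniz rule\<close>

lemma finite_mi_abs_eq [simp]: "finite {\<alpha> :: 'd::finite \<Rightarrow> nat. mi_abs \<alpha> = k}"
proof (rule finite_subset)
  show "{\<alpha> :: 'd \<Rightarrow> nat. mi_abs \<alpha> = k} \<subseteq> (UNIV \<rightarrow>\<^sub>E {..k})"
    by (auto simp: mi_abs_def PiE_def intro: member_le_sum)
  show "finite ((UNIV :: 'd set) \<rightarrow>\<^sub>E {..k})"
    by (intro finite_PiE) auto
qed

lemma sum_mi_abs_le:
  "(\<Sum>\<alpha> | mi_abs (\<alpha> :: 'd::finite \<Rightarrow> nat) \<le> n. f \<alpha>) = (\<Sum>k\<le>n. \<Sum>\<alpha> | mi_abs \<alpha> = k. f \<alpha> :: real)"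
proof -
  have "{\<alpha> :: 'd \<Rightarrow> nat. mi_abs \<alpha> \<le> n} = (\<Union>k\<le>n. {\<alpha>. mi_abs \<alpha> = k})" by auto
  then show ?thesis
    by (simp only:) (subst sum.UNION_disjoint, auto)
qed

text \<open>Written with \<open>\<alpha> i\<close> added on the left so that no truncated
  subtraction occurs; it covers both raising and lowering an entry.\<close>

lemma mi_abs_upd: "mi_abs (\<alpha>(i := m)) + \<alpha> i = mi_abs \<alpha> + m"
proof -
  have "mi_abs (\<alpha>(i := m)) = m + (\<Sum>j\<in>UNIV-{i}. \<alpha> j)"
    unfolding mi_abs_def by (subst sum.remove[of _ i]) auto
  moreover have "mi_abs \<alpha> = \<alpha> i + (\<Sum>j\<in>UNIV-{i}. \<alpha> j)"
    unfolding mi_abs_def by (subst sum.remove[of _ i]) auto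
  ultimately show ?thesis by simp
qed

text \<open>
  The Leibniz rule, normalised: if \<open>F j k\<close> is the \<open>k\<close>-th Taylor coefficient function
  \<open>f\<^sub>j\<^sup>(\<^sup>k\<^sup>) / k!\<close>, then the Cauchy products are the Taylor coefficient functions of \<open>\<Prod>\<^sub>j f\<^sub>j\<close>.
\<close>

lemma has_real_derivative_cauchy_prod:
  fixes F :: "'d::finite \<Rightarrow> nat \<Rightarrow> real \<Rightarrow> real"
  assumes F: "\<And>j k. (F j k has_real_derivative real (Suc k) * F j (Suc k) s) (at s)"
  shows "((\<lambda>s. \<Sum>\<alpha> | mi_abs \<alpha> = k. \<Prod>j\<in>UNIV. F j (\<alpha> j) s) has_real_derivative
    real (Suc k) * (\<Sum>\<alpha> | mi_abs \<alpha> = Suc k. \<Prod>j\<in>UNIV. F j (\<alpha> j) s)) (at s)"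
proof -
  let ?P = "\<lambda>\<alpha>. \<Prod>j\<in>UNIV. F j (\<alpha> j) s"
  let ?up = "\<lambda>(\<alpha>, i). (\<alpha>(i := Suc (\<alpha> i)), i)"
  let ?dn = "\<lambda>(\<beta>, i). (\<beta>(i := \<beta> i - 1), i)"
  \<comment> \<open>The factor \<open>Suc (\<alpha> i)\<close> produced by differentiating factor i
    is the i-th entry of the raised multi-index.\<close>
  have term_eq: "real (Suc (\<alpha> i)) * F i (Suc (\<alpha> i)) s * (\<Prod>j\<in>UNIV-{i}. F j (\<alpha> j) s) =
      real ((\<alpha>(i := Suc (\<alpha> i))) i) * ?P (\<alpha>(i := Suc (\<alpha> i)))" for \<alpha> i
    by (subst prod.remove[of UNIV i]) auto
  have "((\<lambda>s. \<Sum>\<alpha> | mi_abs \<alpha> = k. \<Prod>j\<in>UNIV. F j (\<alpha> j) s) has_real_derivative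
      (\<Sum>\<alpha> | mi_abs \<alpha> = k. \<Sum>i\<in>UNIV. real (Suc (\<alpha> i)) * F i (Suc (\<alpha> i)) s *
        (\<Prod>j\<in>UNIV-{i}. F j (\<alpha> j) s))) (at s)"
    by (intro DERIV_sum has_field_derivative_prod F)
  also have "(\<Sum>\<alpha> | mi_abs \<alpha> = k. \<Sum>i\<in>UNIV. real (Suc (\<alpha> i)) * F i (Suc (\<alpha> i)) s *
        (\<Prod>j\<in>UNIV-{i}. F j (\<alpha> j) s)) =
      (\<Sum>(\<alpha>, i) \<in> {\<alpha>. mi_abs \<alpha> = k} \<times> UNIV.
        real ((\<alpha>(i := Suc (\<alpha> i))) i) * ?P (\<alpha>(i := Suc (\<alpha> i))))"
    by (subst sum.cartesian_product[symmetric]) (simp only: term_eq)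
  \<comment> \<open>Raising entry i is a bijection from pairs with |\<alpha>| = k onto pairs with
    |\<beta>| = k + 1 and \<beta>_i nonzero. The latter condition makes the truncated
    \<open>\<beta> i - 1\<close> in \<open>?dn\<close> a true inverse.\<close>
  also have "\<dots> = (\<Sum>(\<beta>, i) \<in> {(\<beta>, i). mi_abs \<beta> = Suc k \<and> \<beta> i \<noteq> 0}. real (\<beta> i) * ?P \<beta>)"
  proof (rule sum.reindex_bij_witness[where i = ?dn and j = ?up], goal_cases)
    case (1 a)
    then show ?case by (auto simp: fun_eq_iff)
  next
    case (2 a)
    obtain \<alpha> i where a: "a = (\<alpha>, i)" by fastforce
    show ?case
      using 2 mi_abs_upd[of \<alpha> i "Suc (\<alpha> i)"] by (auto simp: a)
  next
    case (3 b)
    then show ?case by (auto simp: fun_eq_iff)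
  next
    case (4 b)
    obtain \<beta> i where b: "b = (\<beta>, i)" by fastforce
    show ?case
      using 4 mi_abs_upd[of \<beta> i "\<beta> i - 1"] by (auto simp: b)
  next
    case (5 a)
    then show ?case by auto
  qed
  \<comment> \<open>Pairs with \<beta>_i = 0 may be added back because their weight
    \<open>real (\<beta> i)\<close> vanishes; the weights over all i then sum to |\<beta>| = k +
    1.\<close>
  also have "\<dots> = (\<Sum>(\<beta>, i) \<in> {\<beta>. mi_abs \<beta> = Suc k} \<times> UNIV. real (\<beta> i) * ?P \<beta>)"
    by (rule sum.mono_neutral_left) auto
  also have "\<dots> = (\<Sum>\<beta> | mi_abs \<beta> = Suc k. \<Sum>i\<in>UNIV. real (\<beta> i) * ?P \<beta>)"
    by (rule sum.cartesian_product[symmetric])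
  also have "\<dots> = (\<Sum>\<beta> | mi_abs \<beta> = Suc k. real (Suc k) * ?P \<beta>)"
    by (rule sum.cong) (auto simp: sum_distrib_right[symmetric] mi_abs_def simp flip: of_nat_sum)
  finally show ?thesis
    by (simp only: sum_distrib_left)
qed

section \<open>Taylor expansion of the Gaussian in Hermite polynomials\<close>

text \<open>One-variable Taylor expansion of s -> exp(-|z - s w|^2) from s = 0 to s = 1. The
  function is a product over the coordinates, so its Taylor coefficients are Cauchy products of the
  one-dimensional ones. The remainder is uniform in z because every Gaussian derivative is
  bounded.\<close>

lemma gauss_hermite_taylor:
  "\<exists>B. \<forall>z w :: real ^ 'd.
    \<bar>exp (- (norm (z - w))\<^sup>2) - exp (- (norm z)\<^sup>2) *
      (\<Sum>\<alpha> | mi_abs \<alpha> \<le> n. (\<Prod>j\<in>UNIV. (w $ j) ^ \<alpha> j) / mi_fact \<alpha> * (\<Prod>j\<in>UNIV. hermite (\<alpha> j) (z $ j)))\<bar>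
    \<le> B * norm w ^ Suc n"
proof -
  let ?g = "\<lambda>m. (deriv ^^ m) (\<lambda>s::real. exp (- (s\<^sup>2)))"
  obtain M where M: "\<And>m x. \<bar>?g m x\<bar> \<le> M m"
    using higher_deriv_gauss_bounded by metis
  define B where "B = (\<Sum>\<alpha> | mi_abs (\<alpha> :: 'd \<Rightarrow> nat) = Suc n. \<Prod>j\<in>UNIV. M (\<alpha> j) / fact (\<alpha> j))"
  have "\<bar>exp (- (norm (z - w))\<^sup>2) - exp (- (norm z)\<^sup>2) *
      (\<Sum>\<alpha> | mi_abs \<alpha> \<le> n. (\<Prod>j\<in>UNIV. (w $ j) ^ \<alpha> j) / mi_fact \<alpha> * (\<Prod>j\<in>UNIV. hermite (\<alpha> j) (z $ j)))\<bar>
    \<le> B * norm w ^ Suc n" for z w :: "real ^ 'd"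
  proof -
    \<comment> \<open>\<open>F j k\<close> is the k-th Taylor coefficient function in s of exp(-(z_j
      - s w_j)^2), and \<open>D k\<close> below is that of the product over j.\<close>
    define F where "F = (\<lambda>j k s. (- (w $ j)) ^ k * ?g k (z $ j - s * w $ j) / fact k)"
    define D where "D = (\<lambda>k s. \<Sum>\<alpha> | mi_abs \<alpha> = k. \<Prod>j\<in>UNIV. F j (\<alpha> j) s)"
    have F: "(F j k has_real_derivative real (Suc k) * F j (Suc k) s) (at s)" for j k s
    proof -
      have "((\<lambda>s. ?g k (z $ j - s * w $ j)) has_real_derivative
          ?g (Suc k) (z $ j - s * w $ j) * (- (w $ j))) (at s)"
        by (rule DERIV_chain2[OF has_real_derivative_higher_deriv_gauss])
          (auto intro!: derivative_eq_intros)
      from DERIV_cdivide[OF DERIV_cmult[OF this, of "(- (w $ j)) ^ k"], of "fact k"]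
      show ?thesis
        unfolding F_def
        by (rule DERIV_cong) (simp add: field_simps del: funpow.simps of_nat_Suc)
    qed
    have D: "(D k has_real_derivative real (Suc k) * D (Suc k) s) (at s)" for k s
      unfolding D_def by (rule has_real_derivative_cauchy_prod[OF F])
    \<comment> \<open>\<open>Maclaurin\<close> expects derivatives, whereas \<open>D m\<close> is
      already divided by m!; hence \<open>fact m * D m\<close>, whose factorials cancel
      again.\<close>
    have "\<exists>\<xi>. 0 < \<xi> \<and> \<xi> < 1 \<and> D 0 1 =
        (\<Sum>m<Suc n. fact m * D m 0 / fact m * 1 ^ m) + fact (Suc n) * D (Suc n) \<xi> / fact (Suc n) * 1 ^ Suc n"
    proof (rule Maclaurin[where diff = "\<lambda>m s. fact m * D m s"])
      show "\<forall>m t. m < Suc n \<and> 0 \<le> t \<and> t \<le> 1 \<longrightarrow>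
          ((\<lambda>s. fact m * D m s) has_real_derivative fact (Suc m) * D (Suc m) t) (at t)"
        using DERIV_cmult[OF D] by (auto simp: algebra_simps)
    qed auto
    then obtain \<xi> where \<xi>: "D 0 1 = (\<Sum>m\<le>n. D m 0) + D (Suc n) \<xi>"
      by (auto simp: lessThan_Suc_atMost simp del: fact_Suc)
    have abs0: "{\<alpha> :: 'd \<Rightarrow> nat. mi_abs \<alpha> = 0} = {\<lambda>_. 0}"
      by (auto simp: mi_abs_def)
    have D0: "D 0 1 = exp (- (norm (z - w))\<^sup>2)"
      by (simp add: D_def abs0 F_def norm_vec_def L2_set_def sum_nonneg
          flip: exp_sum sum_negf)
    have norm_z: "exp (- (norm z)\<^sup>2) = (\<Prod>j\<in>UNIV. exp (- (z $ j)\<^sup>2))"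
      by (simp add: norm_vec_def L2_set_def sum_nonneg flip: exp_sum sum_negf)
    \<comment> \<open>The sign of (-w_j)^k and the factor exp(-z_j^2) cancel against the sign and
      the factor exp(z_j^2) in \<open>hermite\<close>.\<close>
    have F0: "F j k 0 = exp (- (z $ j)\<^sup>2) * ((w $ j) ^ k / fact k * hermite k (z $ j))" for j k
    proof -
      have "(- (w $ j)) ^ k = (-1) ^ k * (w $ j) ^ k"
        by (rule power_minus)
      moreover have "exp (- (z $ j)\<^sup>2) * exp ((z $ j)\<^sup>2) = 1"
        by (simp flip: exp_add)
      ultimately show ?thesis
        by (simp add: F_def hermite_def)
    qed
    have "(\<Sum>m\<le>n. D m 0) = (\<Sum>\<alpha> | mi_abs \<alpha> \<le> n. \<Prod>j\<in>UNIV. F j (\<alpha> j) 0)"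
      by (simp add: D_def sum_mi_abs_le)
    also have "\<dots> = exp (- (norm z)\<^sup>2) *
        (\<Sum>\<alpha> | mi_abs \<alpha> \<le> n. (\<Prod>j\<in>UNIV. (w $ j) ^ \<alpha> j) / mi_fact \<alpha> * (\<Prod>j\<in>UNIV. hermite (\<alpha> j) (z $ j)))"
      by (simp add: F0 norm_z mi_fact_def prod.distrib prod_dividef sum_distrib_left)
    finally have main: "(\<Sum>m\<le>n. D m 0) = \<dots>" .
    have Fle: "\<bar>F j k s\<bar> \<le> norm w ^ k * (M k / fact k)" for j k s
    proof -
      have "\<bar>F j k s\<bar> = \<bar>w $ j\<bar> ^ k * \<bar>?g k (z $ j - s * w $ j)\<bar> / fact k"
        by (simp add: F_def abs_mult power_abs)
      also have "\<dots> \<le> norm w ^ k * M k / fact k"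
        using M component_le_norm_cart[of w j]
        by (intro divide_right_mono mult_mono power_mono) auto
      finally show ?thesis by simp
    qed
    have "\<bar>D (Suc n) \<xi>\<bar> \<le> (\<Sum>\<alpha> | mi_abs (\<alpha> :: 'd \<Rightarrow> nat) = Suc n. \<Prod>j\<in>UNIV. \<bar>F j (\<alpha> j) \<xi>\<bar>)"
      unfolding D_def by (rule order_trans[OF sum_abs]) (simp add: abs_prod)
    \<comment> \<open>The bound \<open>Fle\<close> involves neither z nor \<xi>; the powers of
      \<open>norm w\<close> then combine to the exponent |\<alpha>| = n + 1.\<close>
    also have "\<dots> \<le> (\<Sum>\<alpha> | mi_abs (\<alpha> :: 'd \<Rightarrow> nat) = Suc n.
        \<Prod>j\<in>UNIV. norm w ^ \<alpha> j * (M (\<alpha> j) / fact (\<alpha> j)))"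
      by (intro sum_mono prod_mono) (auto simp del: times_divide_eq_right intro: Fle)
    also have "\<dots> = (\<Sum>\<alpha> | mi_abs (\<alpha> :: 'd \<Rightarrow> nat) = Suc n.
        norm w ^ Suc n * (\<Prod>j\<in>UNIV. M (\<alpha> j) / fact (\<alpha> j)))"
      by (intro sum.cong refl, subst prod.distrib)
        (auto simp: mi_abs_def simp flip: power_sum power_Suc)
    also have "\<dots> = B * norm w ^ Suc n"
      unfolding B_def by (subst mult.commute) (rule sum_distrib_left[symmetric])
    finally show ?thesis
      using \<xi> by (simp add: D0 main)
  qed
  then show ?thesis by blast
qed

section \<open>Functions with all exponential moments\<close>

lemma borel_measurable_lebesgue_continuous:
  fixes f :: "real ^ 'd \<Rightarrow> real"
  assumes "continuous_on UNIV f"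
  shows "f \<in> borel_measurable lebesgue"
  using borel_measurable_continuous_onI[OF assms] by (intro measurable_completion) simp

text \<open>Asking for every exponential weight at once makes the class closed under multiplication
  by exponentials and by polynomials, as repeated differentiation of the Laplace transform
  requires.\<close>

definition exp_integrable :: "(real ^ 'd \<Rightarrow> real) \<Rightarrow> bool" where
  "exp_integrable f \<longleftrightarrow> (\<forall>\<mu>. integrable lebesgue (\<lambda>y. exp (\<mu> \<bullet> y) * f y))"

lemma exp_integrable_measurable:
  "exp_integrable f \<Longrightarrow> f \<in> borel_measurable lebesgue"
  unfolding exp_integrable_def by (drule spec[of _ 0]) (auto dest: borel_measurable_integrable)

lemma exp_integrable_bound:
  fixes f g :: "real ^ 'd \<Rightarrow> real"
  assumes g: "exp_integrable g" and f: "f \<in> borel_measurable lebesgue"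
    and le: "\<And>y. \<bar>f y\<bar> \<le> \<bar>g y\<bar>"
  shows "exp_integrable f"
  unfolding exp_integrable_def
proof
  fix \<mu> :: "real ^ 'd"
  have [measurable]: "(\<lambda>y. exp (\<mu> \<bullet> y)) \<in> borel_measurable lebesgue"
    by (intro borel_measurable_lebesgue_continuous continuous_intros)
  note f[measurable]
  show "integrable lebesgue (\<lambda>y. exp (\<mu> \<bullet> y) * f y)"
    by (rule Bochner_Integration.integrable_bound[of _ "\<lambda>y. exp (\<mu> \<bullet> y) * g y"])
      (use g le in \<open>auto simp: exp_integrable_def abs_mult\<close>)
qed

lemma exp_integrable_add:
  "exp_integrable f \<Longrightarrow> exp_integrable g \<Longrightarrow> exp_integrable (\<lambda>y. f y + g y)"
  by (simp add: exp_integrable_def distrib_left)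

lemma exp_integrable_sum:
  "(\<And>i. i \<in> A \<Longrightarrow> exp_integrable (f i)) \<Longrightarrow> exp_integrable (\<lambda>y. \<Sum>i\<in>A. f i y)"
  by (simp add: exp_integrable_def sum_distrib_left)

lemma exp_integrable_abs:
  assumes "exp_integrable f"
  shows "exp_integrable (\<lambda>y. \<bar>f y\<bar>)"
  using exp_integrable_measurable[OF assms]
  by (intro exp_integrable_bound[OF assms]) auto

lemma exp_integrable_exp:
  assumes "exp_integrable f"
  shows "exp_integrable (\<lambda>y. exp (\<nu> \<bullet> y) * f y)"
  unfolding exp_integrable_def
proof
  fix \<mu>
  have "integrable lebesgue (\<lambda>y. exp ((\<mu> + \<nu>) \<bullet> y) * f y)"
    using assms unfolding exp_integrable_def by blast
  then show "integrable lebesgue (\<lambda>y. exp (\<mu> \<bullet> y) * (exp (\<nu> \<bullet> y) * f y))"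
    by (simp add: inner_add_left exp_add mult.assoc)
qed

text \<open>exp(c |y_j|) is one of exp(c y_j) and exp(-c y_j), hence at most their sum, and each of
  these is an admissible exponential weight.\<close>

lemma exp_integrable_exp_abs_component:
  fixes f :: "real ^ 'd \<Rightarrow> real"
  assumes f: "exp_integrable f"
  shows "exp_integrable (\<lambda>y. exp (c * \<bar>y $ j\<bar>) * f y)"
proof (rule exp_integrable_bound)
  let ?g = "\<lambda>y. exp ((c *\<^sub>R axis j 1) \<bullet> y) * \<bar>f y\<bar> + exp ((- c *\<^sub>R axis j 1) \<bullet> y) * \<bar>f y\<bar>"
  show "exp_integrable ?g"
    by (intro exp_integrable_add exp_integrable_exp exp_integrable_abs f)
  have [measurable]: "(\<lambda>y::real^'d. exp (c * \<bar>y $ j\<bar>)) \<in> borel_measurable lebesgue"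
    by (intro borel_measurable_lebesgue_continuous continuous_intros)
  note exp_integrable_measurable[OF f, measurable]
  show "(\<lambda>y. exp (c * \<bar>y $ j\<bar>) * f y) \<in> borel_measurable lebesgue" by measurable
  show "\<bar>exp (c * \<bar>y $ j\<bar>) * f y\<bar> \<le> \<bar>?g y\<bar>" for y
    by (cases "y $ j \<ge> 0")
      (auto simp: inner_axis' abs_mult abs_of_nonneg)
qed

lemma abs_le_exp_abs: "\<bar>x\<bar> \<le> exp \<bar>x\<bar>" for x :: real
  using exp_ge_add_one_self[of "\<bar>x\<bar>"] by linarith

text \<open>The factor |y_j| is absorbed by exp |y_j|.\<close>

lemma exp_integrable_component:
  fixes f :: "real ^ 'd \<Rightarrow> real"
  assumes f: "exp_integrable f"
  shows "exp_integrable (\<lambda>y. y $ j * f y)"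
proof (rule exp_integrable_bound[OF exp_integrable_exp_abs_component[OF f, of 1 j]])
  have [measurable]: "(\<lambda>y::real^'d. y $ j) \<in> borel_measurable lebesgue"
    by (intro borel_measurable_lebesgue_continuous continuous_intros)
  note exp_integrable_measurable[OF f, measurable]
  show "(\<lambda>y. y $ j * f y) \<in> borel_measurable lebesgue" by measurable
  show "\<bar>y $ j * f y\<bar> \<le> \<bar>exp (1 * \<bar>y $ j\<bar>) * f y\<bar>" for y
    by (auto simp: abs_mult abs_le_exp_abs intro: mult_right_mono)
qed

lemma exp_integrable_component_power:
  "exp_integrable f \<Longrightarrow> exp_integrable (\<lambda>y. y $ j ^ k * f y)"
  by (induction k) (auto simp: mult.assoc dest: exp_integrable_component[where j = j])

text \<open>The Euclidean norm is at most the sum of the |y_j|, which reduces the claim to single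
  components.\<close>

lemma exp_integrable_norm:
  fixes f :: "real ^ 'd \<Rightarrow> real"
  assumes f: "exp_integrable f"
  shows "exp_integrable (\<lambda>y. norm y * f y)"
proof (rule exp_integrable_bound)
  show "exp_integrable (\<lambda>y. \<Sum>j\<in>UNIV. \<bar>y $ j * f y\<bar>)"
    by (intro exp_integrable_sum exp_integrable_abs exp_integrable_component f)
  have [measurable]: "(\<lambda>y::real^'d. norm y) \<in> borel_measurable lebesgue"
    by (intro borel_measurable_lebesgue_continuous continuous_intros)
  note exp_integrable_measurable[OF f, measurable]
  show "(\<lambda>y. norm y * f y) \<in> borel_measurable lebesgue" by measurable
  show "\<bar>norm y * f y\<bar> \<le> \<bar>\<Sum>j\<in>UNIV. \<bar>y $ j * f y\<bar>\<bar>" for y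
    using mult_right_mono[OF norm_le_l1_cart[of y], of "\<bar>f y\<bar>"]
    by (simp add: abs_mult sum_distrib_right abs_of_nonneg sum_nonneg)
qed

lemma exp_integrable_norm_power:
  "exp_integrable f \<Longrightarrow> exp_integrable (\<lambda>y. norm y ^ k * f y)"
  by (induction k) (auto simp: mult.assoc dest: exp_integrable_norm)

section \<open>Differentiating the Laplace transform under the integral\<close>

lemma abs_exp_minus_one_le: "\<bar>exp b - 1\<bar> \<le> \<bar>b\<bar> * exp \<bar>b\<bar>" for b :: real
proof (cases "b \<ge> 0")
  case True
  have "1 - b \<le> exp (- b)"
    using exp_ge_add_one_self[of "- b"] by simp
  then have "(1 - b) * exp b \<le> exp (- b) * exp b"
    by (intro mult_right_mono) auto
  then show ?thesis
    using True by (simp add: algebra_simps flip: exp_add)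
next
  case False
  then have "- b * 1 \<le> - b * exp (- b)"
    by (intro mult_left_mono) auto
  moreover have "\<bar>b\<bar> * exp \<bar>b\<bar> = - b * exp (- b)" "\<bar>exp b - 1\<bar> = 1 - exp b"
    using False by auto
  ultimately show ?thesis
    using exp_ge_add_one_self[of b] by linarith
qed

text \<open>Provides a majorant of the difference quotient that is free of s. The 2 comes from
  bounding both |a| and exp |s a| by exp |a|.\<close>

lemma abs_exp_quotient_le:
  fixes a s :: real
  assumes "s \<noteq> 0" "\<bar>s\<bar> \<le> 1"
  shows "\<bar>(exp (s * a) - 1) / s\<bar> \<le> exp (2 * \<bar>a\<bar>)"
proof -
  have "\<bar>exp (s * a) - 1\<bar> \<le> \<bar>s * a\<bar> * exp \<bar>s * a\<bar>"
    by (rule abs_exp_minus_one_le)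
  then have "\<bar>(exp (s * a) - 1) / s\<bar> \<le> \<bar>a\<bar> * exp \<bar>s * a\<bar>"
    using assms by (simp add: field_simps abs_mult)
  also have "\<dots> \<le> exp \<bar>a\<bar> * exp \<bar>a\<bar>"
    using assms by (intro mult_mono abs_le_exp_abs) (auto simp: abs_mult mult_left_le_one_le)
  finally show ?thesis by (simp flip: exp_add)
qed

text \<open>Dominated convergence for the difference quotients: the majorant carries the extra
  weight exp(2 |y_j|), still integrable since f has all exponential moments. As an equality of
  functions the result can be iterated.\<close>

lemma partial_deriv_bilateral_laplace:
  fixes f :: "real ^ 'd \<Rightarrow> real"
  assumes f: "exp_integrable f"
  shows "partial_deriv j (bilateral_laplace f) = bilateral_laplace (\<lambda>y. y $ j * f y)"
proof
  fix \<eta> :: "real ^ 'd"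
  define \<phi> where "\<phi> = (\<lambda>s y. (exp (s * y $ j) - 1) / s * (exp (\<eta> \<bullet> y) * f y))"
  have int: "integrable lebesgue (\<lambda>y. exp (\<mu> \<bullet> y) * f y)" for \<mu>
    using f by (simp add: exp_integrable_def)
  \<comment> \<open>This includes s = 0, where division by zero makes both sides 0.\<close>
  have quot: "(bilateral_laplace f (\<eta> + s *\<^sub>R axis j 1) - bilateral_laplace f \<eta>) / s
      = (\<integral>y. \<phi> s y \<partial>lebesgue)" for s
    unfolding bilateral_laplace_def
    by (subst Bochner_Integration.integral_diff[symmetric, OF int int],
        subst integral_divide_zero[symmetric])
      (auto intro!: Bochner_Integration.integral_cong
        simp: \<phi>_def inner_add_left inner_axis' exp_add algebra_simps diff_divide_distrib)
  have "((\<lambda>s. \<integral>y. \<phi> s y \<partial>lebesgue) \<longlongrightarrow> bilateral_laplace (\<lambda>y. y $ j * f y) \<eta>) (at 0)"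
    unfolding tendsto_at_iff_sequentially comp_def
  proof (intro allI impI)
    fix S :: "nat \<Rightarrow> real"
    assume S: "\<forall>i. S i \<in> UNIV - {0}" "S \<longlonglongrightarrow> 0"
    have "\<forall>\<^sub>F i in sequentially. \<bar>S i\<bar> < 1"
      using S(2) by (auto dest: tendstoD[where e = 1] simp: dist_real_def)
    \<comment> \<open>The majorant is valid only for |s| <= 1, so the first N terms of the sequence
      are cut off before dominated convergence is applied.\<close>
    then obtain N where N: "\<And>i. i \<ge> N \<Longrightarrow> \<bar>S i\<bar> \<le> 1"
      by (auto simp: eventually_sequentially) (meson less_imp_le)
    have [measurable]: "f \<in> borel_measurable lebesgue"
      by (rule exp_integrable_measurable[OF f])
    have [measurable]: "(\<lambda>y. exp (\<eta> \<bullet> y)) \<in> borel_measurable lebesgue"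
      "(\<lambda>y::real^'d. y $ j) \<in> borel_measurable lebesgue"
      by (intro borel_measurable_lebesgue_continuous continuous_intros)+
    have "(\<lambda>i. \<integral>y. \<phi> (S (i + N)) y \<partial>lebesgue) \<longlonglongrightarrow>
        (\<integral>y. exp (\<eta> \<bullet> y) * (y $ j * f y) \<partial>lebesgue)"
    proof (rule integral_dominated_convergence)
      show "integrable lebesgue (\<lambda>y. exp (\<eta> \<bullet> y) * (exp (2 * \<bar>y $ j\<bar>) * \<bar>f y\<bar>))"
        using exp_integrable_exp_abs_component[OF exp_integrable_abs[OF f], of 2 j]
        by (simp add: exp_integrable_def)
      show "AE y in lebesgue. norm (\<phi> (S (i + N)) y) \<le> exp (\<eta> \<bullet> y) * (exp (2 * \<bar>y $ j\<bar>) * \<bar>f y\<bar>)" for i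
      proof (rule AE_I2)
        fix y :: "real ^ 'd"
        have "\<bar>(exp (S (i + N) * y $ j) - 1) / S (i + N)\<bar> \<le> exp (2 * \<bar>y $ j\<bar>)"
          using S(1) N by (intro abs_exp_quotient_le) auto
        from mult_right_mono[OF this, of "exp (\<eta> \<bullet> y) * \<bar>f y\<bar>"]
        show "norm (\<phi> (S (i + N)) y) \<le> exp (\<eta> \<bullet> y) * (exp (2 * \<bar>y $ j\<bar>) * \<bar>f y\<bar>)"
          unfolding \<phi>_def by (simp only: real_norm_def abs_mult abs_exp_cancel) (simp add: mult_ac)
      qed
      show "AE y in lebesgue. (\<lambda>i. \<phi> (S (i + N)) y) \<longlonglongrightarrow> exp (\<eta> \<bullet> y) * (y $ j * f y)"
      proof (rule AE_I2)
        fix y :: "real ^ 'd"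
        have "((\<lambda>s. exp (s * y $ j)) has_real_derivative y $ j) (at 0)"
          by (auto intro!: derivative_eq_intros)
        then have "((\<lambda>s. (exp (s * y $ j) - 1) / s) \<longlongrightarrow> y $ j) (at 0)"
          by (simp add: has_field_derivative_iff)
        then have "((\<lambda>s. \<phi> s y) \<longlongrightarrow> y $ j * (exp (\<eta> \<bullet> y) * f y)) (at 0)"
          unfolding \<phi>_def by (intro tendsto_intros)
        then have "(\<lambda>i. \<phi> (S i) y) \<longlonglongrightarrow> exp (\<eta> \<bullet> y) * (y $ j * f y)"
          using S unfolding tendsto_at_iff_sequentially comp_def by (simp add: mult_ac)
        then show "(\<lambda>i. \<phi> (S (i + N)) y) \<longlonglongrightarrow> exp (\<eta> \<bullet> y) * (y $ j * f y)"
          by (rule LIMSEQ_ignore_initial_segment)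
      qed
    qed (auto simp: \<phi>_def)
    then show "(\<lambda>i. \<integral>y. \<phi> (S i) y \<partial>lebesgue) \<longlonglongrightarrow> bilateral_laplace (\<lambda>y. y $ j * f y) \<eta>"
      unfolding bilateral_laplace_def by (rule LIMSEQ_offset)
  qed
  then have "((\<lambda>s. bilateral_laplace f (\<eta> + s *\<^sub>R axis j 1)) has_real_derivative
      bilateral_laplace (\<lambda>y. y $ j * f y) \<eta>) (at 0)"
    by (simp add: has_field_derivative_iff quot)
  then show "partial_deriv j (bilateral_laplace f) \<eta> = bilateral_laplace (\<lambda>y. y $ j * f y) \<eta>"
    unfolding partial_deriv_def by (rule DERIV_imp_deriv)
qed

lemma partial_deriv_funpow_bilateral_laplace:
  assumes f: "exp_integrable f"
  shows "(partial_deriv j ^^ k) (bilateral_laplace f) = bilateral_laplace (\<lambda>y. y $ j ^ k * f y)"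
  by (induction k)
    (simp_all add: partial_deriv_bilateral_laplace exp_integrable_component_power f mult.assoc)

text \<open>Each coordinate derivative brings down a power of y_j. The induction runs over an
  arbitrary list of distinct coordinates and carries integrability along, because every further
  derivative needs it for the current integrand.\<close>

lemma mi_deriv_bilateral_laplace:
  fixes f :: "real ^ 'd \<Rightarrow> real"
  assumes f: "exp_integrable f"
  shows "exp_integrable (\<lambda>y. (\<Prod>j\<in>UNIV. y $ j ^ \<alpha> j) * f y)"
    and "mi_deriv \<alpha> (bilateral_laplace f) = bilateral_laplace (\<lambda>y. (\<Prod>j\<in>UNIV. y $ j ^ \<alpha> j) * f y)"
proof -
  have *: "distinct js \<Longrightarrow> exp_integrable (\<lambda>y. (\<Prod>j\<in>set js. y $ j ^ \<alpha> j) * f y) \<and>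
      foldr (\<lambda>j. partial_deriv j ^^ \<alpha> j) js (bilateral_laplace f) =
      bilateral_laplace (\<lambda>y. (\<Prod>j\<in>set js. y $ j ^ \<alpha> j) * f y)" for js
  proof (induction js)
    case (Cons i js)
    then show ?case
      using exp_integrable_component_power[of "\<lambda>y. (\<Prod>j\<in>set js. y $ j ^ \<alpha> j) * f y" i "\<alpha> i"]
      by (simp add: partial_deriv_funpow_bilateral_laplace mult.assoc)
  qed (simp add: f)
  \<comment> \<open>An enumeration exists by finiteness, so the choice in \<open>coord_enum\<close>
    has the intended property.\<close>
  have "distinct (coord_enum :: 'd list) \<and> set (coord_enum :: 'd list) = UNIV"
    unfolding coord_enum_def using finite_distinct_list[of "UNIV :: 'd set"]
    by (intro someI_ex[of "\<lambda>js. distinct js \<and> set js = UNIV"]) auto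
  then show "exp_integrable (\<lambda>y. (\<Prod>j\<in>UNIV. y $ j ^ \<alpha> j) * f y)"
    and "mi_deriv \<alpha> (bilateral_laplace f) = bilateral_laplace (\<lambda>y. (\<Prod>j\<in>UNIV. y $ j ^ \<alpha> j) * f y)"
    using *[of coord_enum] by (simp_all add: mi_deriv_def)
qed

section \<open>Tilting and expanding the heat kernel\<close>

text \<open>Completing the square: the shift by 2t\<eta> makes the cross term, divided by 4t, cancel
  the prefactor up to exp(\<eta>.y). Thus v is the heat evolution of exp(\<eta>.y) u_0(y).\<close>

lemma heat_kernel_tilt:
  assumes "t > 0"
  shows "exp (\<eta> \<bullet> x + t * (norm \<eta>)\<^sup>2) * heat_kernel t (x + (2 * t) *\<^sub>R \<eta> - y)
    = heat_kernel t (x - y) * exp (\<eta> \<bullet> y)"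
proof -
  have "(norm (x + (2 * t) *\<^sub>R \<eta> - y))\<^sup>2 =
      (norm (x - y))\<^sup>2 + 4 * t * (\<eta> \<bullet> x - \<eta> \<bullet> y + t * (norm \<eta>)\<^sup>2)"
    by (simp add: power2_norm_eq_inner inner_simps inner_commute algebra_simps)
  then have "\<eta> \<bullet> x + t * (norm \<eta>)\<^sup>2 - (norm (x + (2 * t) *\<^sub>R \<eta> - y))\<^sup>2 / (4 * t)
      = \<eta> \<bullet> y - (norm (x - y))\<^sup>2 / (4 * t)"
    using assms by (simp add: add_divide_distrib)
  then have "exp (\<eta> \<bullet> x + t * (norm \<eta>)\<^sup>2) * exp (- ((norm (x + (2 * t) *\<^sub>R \<eta> - y))\<^sup>2 / (4 * t)))
      = exp (- ((norm (x - y))\<^sup>2 / (4 * t))) * exp (\<eta> \<bullet> y)"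
    by (simp flip: exp_add)
  then show ?thesis
    by (simp add: heat_kernel_def mult_ac)
qed

text \<open>The Gaussian expansion rescaled by r = 2 sqrt t. The kernel's normalisation contributes
  t^(-d/2) and |w|^(n+1) contributes t^(-(n+1)/2), which together give the stated rate.\<close>

lemma heat_kernel_hermite_expansion:
  "\<exists>C>0. \<forall>(x :: real ^ 'd) y. \<forall>t>0.
    \<bar>heat_kernel t (x - y) - heat_kernel t x *
      (\<Sum>\<alpha> | mi_abs \<alpha> \<le> n. (\<Prod>j\<in>UNIV. y $ j ^ \<alpha> j) / ((4 * t) powr (real (mi_abs \<alpha>) / 2) * mi_fact \<alpha>) *
        (\<Prod>j\<in>UNIV. hermite (\<alpha> j) (x $ j / (2 * sqrt t))))\<bar>
    \<le> C * t powr (- (real (n + CARD('d) + 1) / 2)) * norm y ^ (n + 1)"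
proof -
  obtain B where B: "\<And>z w :: real ^ 'd.
    \<bar>exp (- (norm (z - w))\<^sup>2) - exp (- (norm z)\<^sup>2) *
      (\<Sum>\<alpha> | mi_abs \<alpha> \<le> n. (\<Prod>j\<in>UNIV. (w $ j) ^ \<alpha> j) / mi_fact \<alpha> * (\<Prod>j\<in>UNIV. hermite (\<alpha> j) (z $ j)))\<bar>
    \<le> B * norm w ^ Suc n"
    using gauss_hermite_taylor by blast
  define K where "K = (4 * pi) powr (- (real CARD('d) / 2))"
  \<comment> \<open>\<open>K\<close> is the t-free part of the normalisation. Since the sign of
    \<open>B\<close> is unknown, |B| + 1 replaces it to make \<open>C\<close> positive.\<close>
  define C where "C = K * (\<bar>B\<bar> + 1)"
  have K: "K > 0" by (simp add: K_def)
  have "\<bar>heat_kernel t (x - y) - heat_kernel t x *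
      (\<Sum>\<alpha> | mi_abs \<alpha> \<le> n. (\<Prod>j\<in>UNIV. y $ j ^ \<alpha> j) / ((4 * t) powr (real (mi_abs \<alpha>) / 2) * mi_fact \<alpha>) *
        (\<Prod>j\<in>UNIV. hermite (\<alpha> j) (x $ j / (2 * sqrt t))))\<bar>
    \<le> C * t powr (- (real (n + CARD('d) + 1) / 2)) * norm y ^ (n + 1)"
    if t: "t > 0" for t and x y :: "real ^ 'd"
  proof -
    define r where "r = 2 * sqrt t"
    define z where "z = (1 / r) *\<^sub>R x"
    define w where "w = (1 / r) *\<^sub>R y"
    have r: "r > 0" "r\<^sup>2 = 4 * t" using t by (auto simp: r_def power_mult_distrib)
    have nrm: "(norm ((1 / r) *\<^sub>R v))\<^sup>2 = (norm v)\<^sup>2 / (4 * t)" for v :: "real ^ 'd"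
      using r by (simp add: power_mult_distrib power_divide)
    have scale: "heat_kernel t v = K * t powr (- (real CARD('d) / 2)) * exp (- (norm ((1 / r) *\<^sub>R v))\<^sup>2)"
      for v :: "real ^ 'd"
      unfolding nrm using t by (simp add: heat_kernel_def K_def powr_mult)
    have zw: "z - w = (1 / r) *\<^sub>R (x - y)" by (simp add: z_def w_def scaleR_diff_right)
    have pow: "(4 * t) powr (real m / 2) = r ^ m" for m
    proof -
      have "(4 * t) powr (real m / 2) = (r powr 2) powr (real m / 2)"
        using r by simp
      also have "\<dots> = r powr real m" by (simp add: powr_powr)
      also have "\<dots> = r ^ m" using r by (simp add: powr_realpow)
      finally show ?thesis .
    qed
    have mono: "(\<Prod>j\<in>UNIV. w $ j ^ \<alpha> j) = (\<Prod>j\<in>UNIV. y $ j ^ \<alpha> j) / r ^ mi_abs \<alpha>" for \<alpha>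
      by (simp add: w_def power_divide prod_dividef mi_abs_def power_sum)
    have sums: "(\<Sum>\<alpha> | mi_abs \<alpha> \<le> n. (\<Prod>j\<in>UNIV. y $ j ^ \<alpha> j) / ((4 * t) powr (real (mi_abs \<alpha>) / 2) * mi_fact \<alpha>) *
        (\<Prod>j\<in>UNIV. hermite (\<alpha> j) (x $ j / (2 * sqrt t)))) =
      (\<Sum>\<alpha> | mi_abs \<alpha> \<le> n. (\<Prod>j\<in>UNIV. (w $ j) ^ \<alpha> j) / mi_fact \<alpha> * (\<Prod>j\<in>UNIV. hermite (\<alpha> j) (z $ j)))"
      (is "?S = ?T")
      by (simp add: mono pow z_def r_def)
    have "norm w ^ Suc n = norm y ^ Suc n / r ^ Suc n"
      using r by (simp add: w_def power_divide del: power_Suc)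
    \<comment> \<open>From r >= sqrt t; the gain 2^(-(n+1)) is given away.\<close>
    also have "\<dots> \<le> norm y ^ Suc n / sqrt t ^ Suc n"
      using t by (intro divide_left_mono power_mono mult_pos_pos) (auto simp: r_def)
    also have "sqrt t ^ Suc n = t powr (real (Suc n) / 2)"
      using t by (subst powr_realpow[symmetric]) (auto simp: powr_half_sqrt[symmetric] powr_powr)
    finally have w_le: "norm w ^ Suc n \<le> norm y ^ Suc n * t powr (- (real (Suc n) / 2))"
      by (simp only: powr_minus_divide times_divide_eq_right mult_1_right)
    have "heat_kernel t (x - y) - heat_kernel t x * ?S =
      K * t powr (- (real CARD('d) / 2)) * (exp (- (norm (z - w))\<^sup>2) - exp (- (norm z)\<^sup>2) * ?T)"
      unfolding sums scale zw z_def[symmetric] by (simp add: algebra_simps)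
    then have "\<bar>heat_kernel t (x - y) - heat_kernel t x * ?S\<bar> =
      K * t powr (- (real CARD('d) / 2)) * \<bar>exp (- (norm (z - w))\<^sup>2) - exp (- (norm z)\<^sup>2) * ?T\<bar>"
      using K by (simp only: abs_mult) simp
    also have "\<dots> \<le> K * t powr (- (real CARD('d) / 2)) * (B * norm w ^ Suc n)"
      using K by (intro mult_left_mono B) auto
    also have "\<dots> \<le> K * t powr (- (real CARD('d) / 2)) *
        ((\<bar>B\<bar> + 1) * (norm y ^ Suc n * t powr (- (real (Suc n) / 2))))"
      using K w_le by (intro mult_left_mono mult_mono) auto
    also have "\<dots> = C * (t powr (- (real CARD('d) / 2)) * t powr (- (real (Suc n) / 2))) * norm y ^ (n + 1)"
      by (simp add: C_def)
    also have "t powr (- (real CARD('d) / 2)) * t powr (- (real (Suc n) / 2)) =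
        t powr (- (real (n + CARD('d) + 1) / 2))"
      unfolding powr_add[symmetric] by (rule arg_cong[where f = "(powr) t"]) (simp add: field_simps)
    finally show ?thesis .
  qed
  moreover have "C > 0" using K by (simp add: C_def)
  ultimately show ?thesis by blast
qed

section \<open>Integrating the kernel expansion against the datum\<close>

theorem lemma2p2:
  fixes n :: nat
  shows "\<exists>C>0. \<forall>(u\<^sub>0 :: real ^ 'd \<Rightarrow> real) (\<eta> :: real ^ 'd).
    in_L1 u\<^sub>0 \<longrightarrow> in_Linf u\<^sub>0 \<longrightarrow> L1_norm u\<^sub>0 \<noteq> 0 \<longrightarrow>
    (\<forall>\<mu>. integrable lebesgue (\<lambda>y. exp (\<mu> \<bullet> y) * \<bar>u\<^sub>0 y\<bar>)) \<longrightarrow>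
    (let v = (\<lambda>t x. exp (\<eta> \<bullet> x + t * (norm \<eta>)\<^sup>2) * heat_solution u\<^sub>0 t (x + (2 * t) *\<^sub>R \<eta>))
     in \<forall>x. \<forall>t>0.
       \<bar>v t x - heat_kernel t x *
          (\<Sum>\<alpha> | mi_abs \<alpha> \<le> n.
             mi_deriv \<alpha> (bilateral_laplace u\<^sub>0) \<eta> / ((4 * t) powr (real (mi_abs \<alpha>) / 2) * mi_fact \<alpha>) *
             (\<Prod>j\<in>UNIV. hermite (\<alpha> j) (x $ j / (2 * sqrt t))))\<bar>
       \<le> C * t powr (- (real (n + CARD('d) + 1) / 2)) *
           L1_norm (\<lambda>y. exp (\<eta> \<bullet> y) * norm y ^ (n + 1) * u\<^sub>0 y))"
proof -
  let ?c = "\<lambda>\<alpha> t (x :: real ^ 'd). (\<Prod>j\<in>UNIV. hermite (\<alpha> j) (x $ j / (2 * sqrt t))) /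
    ((4 * t) powr (real (mi_abs \<alpha>) / 2) * mi_fact \<alpha>)"
  \<comment> \<open>\<open>C\<close> is fixed before the datum and \<eta> appear, so it depends on n
    and d only.\<close>
  obtain C where C: "C > 0" and le: "\<And>(x :: real ^ 'd) y t. t > 0 \<Longrightarrow>
    \<bar>heat_kernel t (x - y) - heat_kernel t x *
      (\<Sum>\<alpha> | mi_abs \<alpha> \<le> n. (\<Prod>j\<in>UNIV. y $ j ^ \<alpha> j) / ((4 * t) powr (real (mi_abs \<alpha>) / 2) * mi_fact \<alpha>) *
        (\<Prod>j\<in>UNIV. hermite (\<alpha> j) (x $ j / (2 * sqrt t))))\<bar>
    \<le> C * t powr (- (real (n + CARD('d) + 1) / 2)) * norm y ^ (n + 1)"
    using heat_kernel_hermite_expansion[where 'd = 'd and n = n] by blast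
  have "\<bar>exp (\<eta> \<bullet> x + t * (norm \<eta>)\<^sup>2) * heat_solution u t (x + (2 * t) *\<^sub>R \<eta>) - heat_kernel t x *
      (\<Sum>\<alpha> | mi_abs \<alpha> \<le> n.
         mi_deriv \<alpha> (bilateral_laplace u) \<eta> / ((4 * t) powr (real (mi_abs \<alpha>) / 2) * mi_fact \<alpha>) *
         (\<Prod>j\<in>UNIV. hermite (\<alpha> j) (x $ j / (2 * sqrt t))))\<bar>
    \<le> C * t powr (- (real (n + CARD('d) + 1) / 2)) *
        L1_norm (\<lambda>y. exp (\<eta> \<bullet> y) * norm y ^ (n + 1) * u y)"
    if u1: "in_L1 u" and u: "\<And>\<mu>. integrable lebesgue (\<lambda>y. exp (\<mu> \<bullet> y) * \<bar>u y\<bar>)" and t: "t > 0"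
    for u :: "real ^ 'd \<Rightarrow> real" and \<eta> x t
  proof -
    let ?R = "t powr (- (real (n + CARD('d) + 1) / 2))"
    have [measurable]: "u \<in> borel_measurable lebesgue"
      using u1 by (auto simp: in_L1_def)
    \<comment> \<open>The moments are assumed for |u|; measurability of u transfers them to u
      itself.\<close>
    have ei: "exp_integrable u"
      by (rule exp_integrable_bound[of "\<lambda>y. \<bar>u y\<bar>"]) (auto simp: exp_integrable_def u)
    \<comment> \<open>\<open>P \<alpha>\<close> is the integrand of the derivative of order \<alpha>
      of U_0 at \<eta>, and \<open>Q\<close> below is that of v(t,x).\<close>
    define P where "P = (\<lambda>\<alpha> y. exp (\<eta> \<bullet> y) * ((\<Prod>j\<in>UNIV. y $ j ^ \<alpha> j) * u y))"
    have intP: "integrable lebesgue (P \<alpha>)" for \<alpha>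
      unfolding P_def using mi_deriv_bilateral_laplace(1)[OF ei, of \<alpha>] by (simp add: exp_integrable_def)
    have mi: "mi_deriv \<alpha> (bilateral_laplace u) \<eta> = integral\<^sup>L lebesgue (P \<alpha>)" for \<alpha>
      unfolding mi_deriv_bilateral_laplace(2)[OF ei] by (simp add: bilateral_laplace_def P_def)
    define Q where "Q = (\<lambda>y. heat_kernel t (x - y) * (exp (\<eta> \<bullet> y) * u y))"
    have v: "exp (\<eta> \<bullet> x + t * (norm \<eta>)\<^sup>2) * heat_solution u t (x + (2 * t) *\<^sub>R \<eta>) = integral\<^sup>L lebesgue Q"
      unfolding heat_solution_def Q_def
      by (simp add: heat_kernel_tilt[OF t] flip: integral_mult_right_zero mult.assoc)
    have intE: "integrable lebesgue (\<lambda>y. exp (\<eta> \<bullet> y) * u y)"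
      using ei by (simp add: exp_integrable_def)
    have [measurable]: "(\<lambda>y. heat_kernel t (x - y)) \<in> borel_measurable lebesgue"
      unfolding heat_kernel_def using t
      by (intro borel_measurable_lebesgue_continuous continuous_intros) auto
    \<comment> \<open>The heat kernel never exceeds its value at the origin, so \<open>Q\<close> is
      dominated by a constant multiple of exp(\<eta>.y) |u(y)|.\<close>
    have intQ: "integrable lebesgue Q"
    proof (rule Bochner_Integration.integrable_bound)
      show "integrable lebesgue (\<lambda>y. heat_kernel t (0 :: real ^ 'd) * (exp (\<eta> \<bullet> y) * u y))"
        using intE by simp
      show "Q \<in> borel_measurable lebesgue"
        unfolding Q_def using borel_measurable_integrable[OF intE] by measurable
      show "AE y in lebesgue. norm (Q y) \<le> norm (heat_kernel t (0 :: real ^ 'd) * (exp (\<eta> \<bullet> y) * u y))"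
        using t by (intro AE_I2) (auto simp: Q_def heat_kernel_def abs_mult intro!: mult_left_le_one_le)
    qed
    \<comment> \<open>The whole error is written as one integral, so that the pointwise kernel
      estimate can be applied under it.\<close>
    define W where "W = (\<lambda>y. Q y - heat_kernel t x * (\<Sum>\<alpha> | mi_abs \<alpha> \<le> n. ?c \<alpha> t x * P \<alpha> y))"
    have intW: "integrable lebesgue W"
      unfolding W_def using intP intQ by (intro Bochner_Integration.integrable_diff
        integrable_mult_right Bochner_Integration.integrable_sum) auto
    have "exp (\<eta> \<bullet> x + t * (norm \<eta>)\<^sup>2) * heat_solution u t (x + (2 * t) *\<^sub>R \<eta>) - heat_kernel t x *
      (\<Sum>\<alpha> | mi_abs \<alpha> \<le> n.
         mi_deriv \<alpha> (bilateral_laplace u) \<eta> / ((4 * t) powr (real (mi_abs \<alpha>) / 2) * mi_fact \<alpha>) *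
         (\<Prod>j\<in>UNIV. hermite (\<alpha> j) (x $ j / (2 * sqrt t)))) = integral\<^sup>L lebesgue W"
      unfolding v mi W_def
      by (subst Bochner_Integration.integral_diff)
        (use intP intQ in \<open>auto intro!: sum.cong Bochner_Integration.integrable_sum
          simp: Bochner_Integration.integral_sum\<close>)
    moreover have "\<bar>integral\<^sup>L lebesgue W\<bar> \<le> (\<integral>y. \<bar>W y\<bar> \<partial>lebesgue)"
      by (rule integral_abs_bound)
    moreover have "\<dots> \<le> (\<integral>y. C * ?R * \<bar>exp (\<eta> \<bullet> y) * norm y ^ (n + 1) * u y\<bar> \<partial>lebesgue)"
    proof (rule integral_mono)
      show "integrable lebesgue (\<lambda>y. \<bar>W y\<bar>)" using intW by simp
      have "integrable lebesgue (\<lambda>y. exp (\<eta> \<bullet> y) * norm y ^ (n + 1) * u y)"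
        using exp_integrable_norm_power[OF ei, of "n + 1"]
        by (simp only: exp_integrable_def mult.assoc)
      then show "integrable lebesgue (\<lambda>y. C * ?R * \<bar>exp (\<eta> \<bullet> y) * norm y ^ (n + 1) * u y\<bar>)"
        by (intro integrable_mult_right integrable_abs)
      fix y :: "real ^ 'd"
      let ?S = "\<Sum>\<alpha> | mi_abs \<alpha> \<le> n. (\<Prod>j\<in>UNIV. y $ j ^ \<alpha> j) / ((4 * t) powr (real (mi_abs \<alpha>) / 2) * mi_fact \<alpha>) *
          (\<Prod>j\<in>UNIV. hermite (\<alpha> j) (x $ j / (2 * sqrt t)))"
      let ?E = "heat_kernel t (x - y) - heat_kernel t x * ?S"
      \<comment> \<open>The weight exp(\<eta>.y) u(y) is common to all terms; factored out, it
        leaves exactly the kernel error \<open>?E\<close> bounded by \<open>le\<close>.\<close>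
      have "(\<Sum>\<alpha> | mi_abs \<alpha> \<le> n. ?c \<alpha> t x * P \<alpha> y) = ?S * (exp (\<eta> \<bullet> y) * u y)"
        unfolding sum_distrib_right by (rule sum.cong) (auto simp: P_def)
      then have "W y = ?E * (exp (\<eta> \<bullet> y) * u y)"
        by (simp only: W_def Q_def left_diff_distrib mult.assoc)
      then have "\<bar>W y\<bar> = \<bar>?E\<bar> * (exp (\<eta> \<bullet> y) * \<bar>u y\<bar>)"
        by (simp only: abs_mult abs_exp_cancel)
      also have "\<dots> \<le> (C * ?R * norm y ^ (n + 1)) * (exp (\<eta> \<bullet> y) * \<bar>u y\<bar>)"
        by (intro mult_right_mono le t) auto
      also have "\<dots> = C * ?R * \<bar>exp (\<eta> \<bullet> y) * norm y ^ (n + 1) * u y\<bar>"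
        by (simp add: abs_mult mult_ac)
      finally show "\<bar>W y\<bar> \<le> C * ?R * \<bar>exp (\<eta> \<bullet> y) * norm y ^ (n + 1) * u y\<bar>" .
    qed
    moreover have "\<dots> = C * ?R * L1_norm (\<lambda>y. exp (\<eta> \<bullet> y) * norm y ^ (n + 1) * u y)"
      unfolding L1_norm_def by (rule integral_mult_right_zero)
    ultimately show ?thesis by linarith
  qed
  with C show ?thesis
    unfolding Let_def by blast
qed

end
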